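(* Consider online mixed packing and covering (defined in the context) and the doubling version of Algorithm MPC-Approx described in the context. Let $T$ be the last trial and, for each trial $\tau\le T$, let $\lambda^f(\tau)=\max_k(\mathbf{P}\mathbf{x}(\tau))_k$ be the value of the primal objective of trial $\tau$ when that trial ends. Then $\sum_{\tau\le T}\lambda^f(\tau)=O(\ln m\,\ln(d\rho\kappa))\cdot OPT$. (Since the final solution is $\mathbf{x}=\sum_\tau \mathbf{x}(\tau)$, its value $\max_k(\mathbf{P}\mathbf{x})_k$ is at most this sum.)
   Context: Online mixed packing and covering (OMPC): there are $n$ nonnegative variables $\mathbf{x}=(x_1,\dots,x_n)$. A nonnegative $m\times n$ matrix $\mathbf{P}=(p_{kj})$ (packing constraints) is known in advance; the rows of a nonnegative $m_c\times n$ matrix $\mathbf{C}=(c_{ij})$ (covering constraints $(\mathbf{C}\mathbf{x})_i\ge 1$) arrive one at a time. The goal is to solve $\min \lambda$ s.t. $\mathbf{C}\mathbf{x}\ge\mathbf{1}$, $\mathbf{P}\mathbf{x}\le\lambda\mathbf{1}$, $\mathbf{x}\ge 0$ online: after each arrival the variables may only be increased, and the newly arrived covering constraint must be satisfied. $OPT$ is the optimal value of this LP for the full $\mathbf{P},\mathbf{C}$. Parameters: $d$ is the maximum number of variables (nonzero coefficients) in any packing or covering constraint; $\rho=\max_{k,j}p_{kj}/\min_{k,j:p_{kj}>0}p_{kj}$; $\kappa=\max_{i,j}c_{ij}/\min_{i,j:c_{ij}>0}c_{ij}$; $\kappa_1=\max_j c_{1j}$ for the first covering constraint to arrive; $d_1$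 is the maximum number of variables in any packing constraint or in the first covering constraint; $\mu=1+\frac{1}{3\ln(em)}$; $\sigma=e^2\ln(\mu d^2\rho\kappa)$. Algorithm MPC-Approx with scaling parameter $\Gamma>0$: let $\tilde{\mathbf{P}}=\mathbf{P}/\Gamma$, $\tilde\lambda(\mathbf{x})=\max_k(\tilde{\mathbf{P}}\mathbf{x})_k$, $\Phi(\mathbf{x})=\ln\sum_{k=1}^m\exp((\tilde{\mathbf{P}}\mathbf{x})_k)$ and $r_j(\mathbf{x})=\partial\Phi/\partial x_j=\frac{\sum_k\tilde p_{kj}\exp((\tilde{\mathbf{P}}\mathbf{x})_k)}{\sum_k\exp((\tilde{\mathbf{P}}\mathbf{x})_k)}$. When the first covering constraint arrives, set $x_j=1/(d_1^2\rho\kappa_1)$ for all $j$. When the $i$-th covering constraint arrives (with a new variable $y_i=0$), repeat the following phase while $(\mathbf{C}\mathbf{x})_i<1$: let $\mathbf{x}^l$ be the current $\mathbf{x}$; set $\epsilon_i=(\mu-1)\min_{j:c_{ij}>0}r_j(\mathbf{x}^l)/c_{ij}$; for every $j$ set $x_j\leftarrow x_j(1+\epsilon_i c_{ij}/r_j(\mathbf{x}^l))$; set $y_i\leftarrow y_i+e\epsilon_i$; if $\tilde\lambda(\mathbf{x})\ge 3\ln(em)$, stop and return FAIL. Doubling version: initially $\Gamma=\max_{k,j}p_{kj}/(d_1\rho\kappa_1)$. Each execution of MPC-Approx with fresh variables $\mathbf{x}(\tau)$ (initialized to $1/(d_1^2\rho\kappa_1)$) is a trial $\tau$; if a trial fails,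 $\Gamma$ is doubled and a new trial with fresh variables is started, continuing with the covering constraints not yet satisfied. The solution output is $\mathbf{x}=\sum_\tau\mathbf{x}(\tau)$. *)

theory Defs
  imports Complex_Main
begin

text \<open>
  Vectors are functions on indices below \<open>nvars\<close>, and matrices are functions of a row and a column
  index; indices start at 0, so row 0 of the covering matrix is the first constraint to arrive.
  Dimensions are ordinary numbers because the constant in the bound must not depend on them.
\<close>

record ompc =
  npack :: nat
  ncov :: nat
  nvars :: nat
  pcoef :: "nat \<Rightarrow> nat \<Rightarrow> real"
  ccoef :: "nat \<Rightarrow> nat \<Rightarrow> real"

text \<open>
  A covering row of zeros would make the linear program infeasible. If a variable occurred in a
  covering constraint but in no packing constraint, the quotients \<open>c\<^sub>i\<^sub>j / r\<^sub>j\<close> used by the algorithm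
  would have denominator 0.
\<close>

definition ompc_instance :: "ompc \<Rightarrow> bool" where
  "ompc_instance I \<longleftrightarrow>
     0 < ncov I \<and>
     (\<forall>k<npack I. \<forall>j<nvars I. 0 \<le> pcoef I k j) \<and>
     (\<forall>i<ncov I. \<forall>j<nvars I. 0 \<le> ccoef I i j) \<and>
     (\<forall>i<ncov I. \<exists>j<nvars I. 0 < ccoef I i j) \<and>
     (\<forall>i<ncov I. \<forall>j<nvars I. 0 < ccoef I i j \<longrightarrow> (\<exists>k<npack I. 0 < pcoef I k j))"

definition pack_row :: "ompc \<Rightarrow> (nat \<Rightarrow> real) \<Rightarrow> nat \<Rightarrow> real" where
  "pack_row I x k = (\<Sum>j<nvars I. pcoef I k j * x j)"

definition cov_row :: "ompc \<Rightarrow> (nat \<Rightarrow> real) \<Rightarrow> nat \<Rightarrow> real" where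
  "cov_row I x i = (\<Sum>j<nvars I. ccoef I i j * x j)"

definition max_load :: "ompc \<Rightarrow> (nat \<Rightarrow> real) \<Rightarrow> real" where
  "max_load I x = Max {pack_row I x k |k. k < npack I}"

definition OPT :: "ompc \<Rightarrow> real" where
  "OPT I = Inf {l. \<exists>x. (\<forall>j<nvars I. 0 \<le> x j) \<and>
                       (\<forall>i<ncov I. 1 \<le> cov_row I x i) \<and>
                       (\<forall>k<npack I. pack_row I x k \<le> l)}"


definition pack_size :: "ompc \<Rightarrow> nat \<Rightarrow> nat" where
  "pack_size I k = card {j. j < nvars I \<and> pcoef I k j \<noteq> 0}"

definition cov_size :: "ompc \<Rightarrow> nat \<Rightarrow> nat" where
  "cov_size I i = card {j. j < nvars I \<and> ccoef I i j \<noteq> 0}"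

definition d_all :: "ompc \<Rightarrow> nat" where
  "d_all I = Max ({pack_size I k |k. k < npack I} \<union> {cov_size I i |i. i < ncov I})"

definition d_first :: "ompc \<Rightarrow> nat" where
  "d_first I = Max ({pack_size I k |k. k < npack I} \<union> {cov_size I 0})"

definition pmax :: "ompc \<Rightarrow> real" where
  "pmax I = Max {pcoef I k j |k j. k < npack I \<and> j < nvars I}"

definition rho :: "ompc \<Rightarrow> real" where
  "rho I = pmax I / Min {pcoef I k j |k j. k < npack I \<and> j < nvars I \<and> 0 < pcoef I k j}"

definition kappa :: "ompc \<Rightarrow> real" where
  "kappa I = Max {ccoef I i j |i j. i < ncov I \<and> j < nvars I} /
             Min {ccoef I i j |i j. i < ncov I \<and> j < nvars I \<and> 0 < ccoef I i j}"

definition kappa_first :: "ompc \<Rightarrow> real" where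
  "kappa_first I = Max {ccoef I 0 j |j. j < nvars I}"


definition fail_bound :: "ompc \<Rightarrow> real" where
  "fail_bound I = 3 * ln (exp 1 * real (npack I))"

definition mu :: "ompc \<Rightarrow> real" where
  "mu I = 1 + 1 / (3 * ln (exp 1 * real (npack I)))"

definition scaled :: "real \<Rightarrow> ompc \<Rightarrow> ompc" where
  "scaled \<Gamma> I = I\<lparr>pcoef := \<lambda>k j. pcoef I k j / \<Gamma>\<rparr>"

text \<open>
  The partial derivative with respect to \<open>x\<^sub>j\<close> of \<open>ln (\<Sum>k. exp ((P x)\<^sub>k))\<close>. The algorithm uses it,
  like the two definitions after it, on the scaled instance.
\<close>

definition rate :: "ompc \<Rightarrow> (nat \<Rightarrow> real) \<Rightarrow> nat \<Rightarrow> real" where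
  "rate I x j =
     (\<Sum>k<npack I. pcoef I k j * exp (pack_row I x k)) / (\<Sum>k<npack I. exp (pack_row I x k))"

definition step_size :: "ompc \<Rightarrow> (nat \<Rightarrow> real) \<Rightarrow> nat \<Rightarrow> real" where
  "step_size I x i =
     (mu I - 1) * Min {rate I x j / ccoef I i j |j. j < nvars I \<and> 0 < ccoef I i j}"

definition phase :: "ompc \<Rightarrow> (nat \<Rightarrow> real) \<Rightarrow> nat \<Rightarrow> (nat \<Rightarrow> real)" where
  "phase I x i = (\<lambda>j. x j * (1 + step_size I x i * ccoef I i j / rate I x j))"

definition x_init :: "ompc \<Rightarrow> nat \<Rightarrow> real" where
  "x_init I = (\<lambda>j. 1 / ((real (d_first I))\<^sup>2 * rho I * kappa_first I))"

definition Gamma_init :: "ompc \<Rightarrow> real" where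
  "Gamma_init I = pmax I / (real (d_first I) * rho I * kappa_first I)"

text \<open>
  A configuration \<open>(\<Gamma>, zs, i, x)\<close> of the doubling algorithm consists of the current scaling
  parameter, the final vectors of the failed trials in order, the index of the covering constraint
  being processed, and the vector of the current trial. The dual variables \<open>y\<^sub>i\<close> are left out: they
  influence neither the vectors nor the control flow.

  After a failure the new trial goes on from the current constraint. Rule \<open>passed\<close> permits a trial
  to leave a constraint that the earlier trials together already satisfy, but does not force it to,
  so the runs include both those that skip such constraints and those that process them.
\<close>

type_synonym config = "real \<times> (nat \<Rightarrow> real) list \<times> nat \<times> (nat \<Rightarrow> real)"

inductive doubling_step :: "ompc \<Rightarrow> config \<Rightarrow> config \<Rightarrow> bool" for I :: ompc where
  satisfied:
    "\<lbrakk>i < ncov I; 1 \<le> cov_row I x i\<rbrakk>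
     \<Longrightarrow> doubling_step I (\<Gamma>, zs, i, x) (\<Gamma>, zs, Suc i, x)"
| passed:
    "\<lbrakk>i < ncov I; 1 \<le> cov_row I (\<lambda>j. \<Sum>z\<leftarrow>zs. z j) i\<rbrakk>
     \<Longrightarrow> doubling_step I (\<Gamma>, zs, i, x) (\<Gamma>, zs, Suc i, x)"
| increase:
    "\<lbrakk>i < ncov I; cov_row I x i < 1; x' = phase (scaled \<Gamma> I) x i;
      max_load (scaled \<Gamma> I) x' < fail_bound I\<rbrakk>
     \<Longrightarrow> doubling_step I (\<Gamma>, zs, i, x) (\<Gamma>, zs, i, x')"
| failure:
    "\<lbrakk>i < ncov I; cov_row I x i < 1; x' = phase (scaled \<Gamma> I) x i;
      fail_bound I \<le> max_load (scaled \<Gamma> I) x'\<rbrakk>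
     \<Longrightarrow> doubling_step I (\<Gamma>, zs, i, x) (2 * \<Gamma>, zs @ [x'], i, x_init I)"

text \<open>
  \<open>doubling_run I xs\<close>: some complete run on \<open>I\<close> has \<open>length xs\<close> trials, and \<open>xs\<close> lists their vectors
  at the time each of them ends, the last one ending when all covering constraints are processed.
\<close>

definition doubling_run :: "ompc \<Rightarrow> (nat \<Rightarrow> real) list \<Rightarrow> bool" where
  "doubling_run I xs \<longleftrightarrow>
     (\<exists>\<Gamma> zs x. (doubling_step I)\<^sup>*\<^sup>* (Gamma_init I, [], 0, x_init I) (\<Gamma>, zs, ncov I, x) \<and>
               xs = zs @ [x])"

end

theory Submission
  imports Defs
begin

text \<open>
  Within a trial, a phase of step size \<open>\<epsilon>\<close> raises the potential \<open>\<Phi> = ln (\<Sum>k. exp (P x)\<^sub>k)\<close> by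
  at most \<open>2 \<epsilon>\<close>. If \<open>x\<^sup>*\<close> is feasible, the sum of the step sizes is at most
  \<open>\<Sum>j. x\<^sup>*\<^sub>j u\<^sub>j\<close>, where \<open>u\<^sub>j\<close> is the sum of \<open>\<epsilon> c\<^sub>i\<^sub>j\<close> over the phases. Each \<open>\<epsilon> c\<^sub>i\<^sub>j\<close>
  equals \<open>r\<^sub>j\<close> times the relative growth of \<open>x\<^sub>j\<close>, so \<open>u\<^sub>j\<close> is at most twice \<open>max r\<^sub>j\<close> over
  the phases times the logarithm of the total growth of \<open>x\<^sub>j\<close>, and this logarithm is
  \<open>O(ln (d \<rho> \<kappa>))\<close>. The maxima over time of the softmax weights of the packing rows sum to at
  most \<open>1 + \<Delta>\<Phi>\<close>, since a weight increases only at the expense of an increase of the potential.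
  Hence \<open>\<Delta>\<Phi> \<le> O(ln (d \<rho> \<kappa>)) (OPT / \<Gamma>) (1 + \<Delta>\<Phi>)\<close>, and a trial cannot fail once \<open>\<Gamma>\<close> exceeds
  a suitable multiple of \<open>ln (d \<rho> \<kappa>) OPT\<close>. Every trial ends with load \<open>O(\<Gamma> ln (e m))\<close>, and the
  values of \<open>\<Gamma>\<close> form a geometric progression that starts below \<open>OPT\<close>.
\<close>

section \<open>Packing loads and the potential\<close>

lemma ompc_instanceD:
  assumes "ompc_instance I"
  shows "\<And>k j. k < npack I \<Longrightarrow> j < nvars I \<Longrightarrow> 0 \<le> pcoef I k j"
    and "\<And>i j. i < ncov I \<Longrightarrow> j < nvars I \<Longrightarrow> 0 \<le> ccoef I i j"
    and "\<And>i. i < ncov I \<Longrightarrow> \<exists>j<nvars I. 0 < ccoef I i j"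
    and "\<And>i j. i < ncov I \<Longrightarrow> j < nvars I \<Longrightarrow> 0 < ccoef I i j \<Longrightarrow> \<exists>k<npack I. 0 < pcoef I k j"
    and "0 < ncov I"
  using assms unfolding ompc_instance_def by blast+

lemma ompc_instance_npack_pos: "ompc_instance I \<Longrightarrow> 0 < npack I"
  using ompc_instanceD(3-5)[of I] by (metis gr0I not_less_zero)

lemma max_load_le_iff:
  assumes "0 < npack I"
  shows "max_load I x \<le> b \<longleftrightarrow> (\<forall>k<npack I. pack_row I x k \<le> b)"
proof -
  have "{pack_row I x k |k. k < npack I} = pack_row I x ` {..<npack I}" by auto
  then show ?thesis
    unfolding max_load_def using assms by (subst Max_le_iff) auto
qed

lemma pack_row_le_max_load: "k < npack I \<Longrightarrow> pack_row I x k \<le> max_load I x"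
  using max_load_le_iff[of I x "max_load I x"] by auto

lemma pack_row_sum_list:
  "pack_row I (\<lambda>j. \<Sum>x\<leftarrow>xs. x j) k = (\<Sum>x\<leftarrow>xs. pack_row I x k)"
  by (induction xs) (auto simp: pack_row_def algebra_simps sum.distrib)

lemma max_load_sum_list:
  assumes "0 < npack I"
  shows "max_load I (\<lambda>j. \<Sum>x\<leftarrow>xs. x j) \<le> (\<Sum>x\<leftarrow>xs. max_load I x)"
  unfolding max_load_le_iff[OF assms] pack_row_sum_list
  by (auto intro!: sum_list_mono pack_row_le_max_load)

definition expsum :: "ompc \<Rightarrow> (nat \<Rightarrow> real) \<Rightarrow> real" where
  "expsum I x = (\<Sum>k<npack I. exp (pack_row I x k))"

definition potential :: "ompc \<Rightarrow> (nat \<Rightarrow> real) \<Rightarrow> real" where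
  "potential I x = ln (expsum I x)"

lemma expsum_pos: "0 < npack I \<Longrightarrow> 0 < expsum I x"
  unfolding expsum_def by (intro sum_pos) auto

lemma max_load_le_potential:
  assumes "0 < npack I"
  shows "max_load I x \<le> potential I x"
  unfolding max_load_le_iff[OF assms]
proof (intro allI impI)
  fix k assume "k < npack I"
  then have "exp (pack_row I x k) \<le> expsum I x"
    unfolding expsum_def by (intro member_le_sum) auto
  then show "pack_row I x k \<le> potential I x"
    unfolding potential_def using expsum_pos[OF assms] by (simp add: ln_ge_iff)
qed

text \<open>Each of the \<open>m\<close> summands is at most \<open>exp b\<close>. With
  \<open>max_load_le_potential\<close>, the potential is a smooth maximum that exceeds the largest
  load by at most \<open>ln m\<close>, so bounds on potential and on load can be exchanged at that
  cost.\<close>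

lemma potential_le:
  assumes m: "0 < npack I" and b: "max_load I x \<le> b"
  shows "potential I x \<le> ln (npack I) + b"
proof -
  have "expsum I x \<le> (\<Sum>k<npack I. exp b)"
    unfolding expsum_def using b max_load_le_iff[OF m] by (intro sum_mono) auto
  then have "ln (expsum I x) \<le> ln (npack I * exp b)"
    using expsum_pos[OF m] by (subst ln_le_cancel_iff) (auto simp: m)
  also have "\<dots> = ln (npack I) + b"
    using m by (simp add: ln_mult)
  finally show ?thesis by (simp add: potential_def)
qed

lemma rate_expsum:
  "rate I x j = (\<Sum>k<npack I. pcoef I k j * (exp (pack_row I x k) / expsum I x))"
  unfolding rate_def expsum_def by (simp add: sum_divide_distrib)

lemma rate_pos:
  assumes I: "ompc_instance I" and ij: "i < ncov I" "j < nvars I" "0 < ccoef I i j"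
  shows "0 < rate I x j"
proof -
  obtain k where k: "k < npack I" "0 < pcoef I k j"
    using ompc_instanceD(4)[OF I ij] by blast
  have "0 < (\<Sum>k<npack I. pcoef I k j * exp (pack_row I x k))"
    using k ompc_instanceD(1)[OF I] ij by (intro sum_pos2[of _ k]) auto
  then show ?thesis
    using expsum_pos[of I x] k unfolding rate_def expsum_def by auto
qed

lemma fail_bound_eq: "0 < npack I \<Longrightarrow> fail_bound I = 3 * (1 + ln (npack I))"
  by (simp add: fail_bound_def ln_mult)

lemma fail_bound_ge: "0 < npack I \<Longrightarrow> 3 \<le> fail_bound I"
  by (simp add: fail_bound_eq)

lemma mu_eq: "mu I = 1 + 1 / fail_bound I"
  by (simp add: mu_def fail_bound_def)

section \<open>A single trial\<close>

text \<open>The relative growth of \<open>x j\<close> in one phase.\<close>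

definition gain :: "ompc \<Rightarrow> (nat \<Rightarrow> real) \<Rightarrow> nat \<Rightarrow> nat \<Rightarrow> real" where
  "gain I x i j = step_size I x i * ccoef I i j / rate I x j"

lemma phase_gain: "phase I x i j = x j * (1 + gain I x i j)"
  by (simp add: phase_def gain_def)

lemma step_size_nonneg_and_le:
  assumes I: "ompc_instance I" and i: "i < ncov I"
  shows "0 \<le> step_size I x i"
    and "\<And>j. j < nvars I \<Longrightarrow> 0 < ccoef I i j \<Longrightarrow>
      step_size I x i \<le> rate I x j / ccoef I i j / fail_bound I"
proof -
  let ?S = "{rate I x j / ccoef I i j |j. j < nvars I \<and> 0 < ccoef I i j}"
  have F: "0 < fail_bound I" using fail_bound_ge[of I] ompc_instance_npack_pos[OF I] by simp
  have fin: "finite ?S" by auto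
  have ne: "?S \<noteq> {}" using ompc_instanceD(3)[OF I i] by auto
  have step: "step_size I x i = Min ?S / fail_bound I" by (simp add: step_size_def mu_eq)
  have "Min ?S \<in> ?S" using Min_in[OF fin ne] .
  then obtain j where "Min ?S = rate I x j / ccoef I i j" "j < nvars I" "0 < ccoef I i j"
    by blast
  then have "0 \<le> Min ?S" using rate_pos[OF I i, of j x] by simp
  then show "0 \<le> step_size I x i" unfolding step using F by simp
  fix j assume "j < nvars I" "0 < ccoef I i j"
  then have "Min ?S \<le> rate I x j / ccoef I i j" by (intro Min_le[OF fin]) auto
  then show "step_size I x i \<le> rate I x j / ccoef I i j / fail_bound I"
    unfolding step using F by (intro divide_right_mono) auto
qed

text \<open>The step size is the largest for which no variable grows by a factor beyond
  \<open>mu I\<close>. The last identity is the link between primal and dual: rate times relative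
  growth is the amount by which the dual load of variable \<open>j\<close> rises.\<close>

lemma gain_bounds:
  assumes I: "ompc_instance I" and i: "i < ncov I" and j: "j < nvars I"
  shows "0 \<le> gain I x i j" and "gain I x i j \<le> 1 / fail_bound I" and "gain I x i j \<le> 1"
    and "rate I x j * gain I x i j = step_size I x i * ccoef I i j"
proof -
  have F: "3 \<le> fail_bound I" using fail_bound_ge[of I] ompc_instance_npack_pos[OF I] by simp
  have "0 \<le> gain I x i j \<and> gain I x i j \<le> 1 / fail_bound I \<and>
      rate I x j * gain I x i j = step_size I x i * ccoef I i j"
  \<comment> \<open>If the coefficient is 0, the rate may be 0 as well; the quotient is then 0 by
    the convention for division, and all claims still hold.\<close>
  proof (cases "ccoef I i j = 0")
    case True
    then show ?thesis using F by (simp add: gain_def)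
  next
    case False
    then have c: "0 < ccoef I i j" using ompc_instanceD(2)[OF I i j] by simp
    note r = rate_pos[OF I i j c, of x]
    note s = step_size_nonneg_and_le[OF I i, where x = x]
    have "step_size I x i * ccoef I i j / rate I x j \<le> 1 / fail_bound I"
      using s(2)[OF j c] r c F by (simp add: field_simps)
    then show ?thesis using s(1) r c by (simp add: gain_def)
  qed
  moreover have "1 / fail_bound I \<le> 1" using F by simp
  ultimately show "0 \<le> gain I x i j" "gain I x i j \<le> 1 / fail_bound I" "gain I x i j \<le> 1"
    "rate I x j * gain I x i j = step_size I x i * ccoef I i j" by linarith+
qed

lemma pack_row_phase:
  "pack_row I (phase I x i) k = pack_row I x k + (\<Sum>j<nvars I. pcoef I k j * x j * gain I x i j)"
  unfolding pack_row_def phase_gain by (simp add: algebra_simps sum.distrib)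

text \<open>A load of at most \<open>fail_bound I\<close> grows by a factor of at most
  \<open>1 + 1 / fail_bound I\<close>, hence by at most 1. This keeps the increments in the range
  where \<open>exp\<close> has a linear upper bound.\<close>

lemma pack_row_phase_bounds:
  assumes I: "ompc_instance I" and i: "i < ncov I" and k: "k < npack I"
    and x: "\<And>j. j < nvars I \<Longrightarrow> 0 \<le> x j" and load: "pack_row I x k \<le> fail_bound I"
  shows "0 \<le> (\<Sum>j<nvars I. pcoef I k j * x j * gain I x i j)"
    and "(\<Sum>j<nvars I. pcoef I k j * x j * gain I x i j) \<le> 1"
proof -
  note p = ompc_instanceD(1)[OF I k]
  have F: "3 \<le> fail_bound I" using fail_bound_ge[of I] ompc_instance_npack_pos[OF I] by simp
  show "0 \<le> (\<Sum>j<nvars I. pcoef I k j * x j * gain I x i j)"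
    using p x gain_bounds(1)[OF I i] by (intro sum_nonneg) auto
  have "(\<Sum>j<nvars I. pcoef I k j * x j * gain I x i j)
      \<le> (\<Sum>j<nvars I. pcoef I k j * x j * (1 / fail_bound I))"
    using p x gain_bounds(2)[OF I i] by (intro sum_mono mult_left_mono) auto
  also have "\<dots> = pack_row I x k / fail_bound I"
    by (simp add: pack_row_def sum_divide_distrib)
  also have "\<dots> \<le> 1" using load F by simp
  finally show "(\<Sum>j<nvars I. pcoef I k j * x j * gain I x i j) \<le> 1" .
qed

section \<open>Elementary inequalities for the exponential and the logarithm\<close>

lemma exp_le_linear: "0 \<le> t \<Longrightarrow> t \<le> 1 \<Longrightarrow> exp t \<le> 1 + 2 * (t::real)"
  using exp_bound[of t] mult_left_le[of t t] by (simp add: power2_eq_square)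

lemma le_two_ln: "0 \<le> t \<Longrightarrow> t \<le> 1 \<Longrightarrow> t \<le> 2 * ln (1 + (t::real))"
  using exp_le_linear[of "t / 2"] ln_ge_iff[of "1 + t" "t / 2"] by simp

lemma one_minus_inverse_le_ln: "0 < t \<Longrightarrow> 1 - 1 / t \<le> ln (t::real)"
  using ln_le_minus_one[of "1 / t"] by (simp add: ln_div)

text \<open>To first order, \<open>expsum\<close> changes by \<open>expsum I x\<close> times the sum
  of \<open>x j * rate I x j * gain I x i j\<close>. By the identity for \<open>gain\<close> this
  sum is the step size times the covering value, which is at most 1 before the phase. Bounding
  \<open>exp\<close> linearly costs the factor 2.\<close>

lemma expsum_phase:
  assumes I: "ompc_instance I" and i: "i < ncov I"
    and x: "\<And>j. j < nvars I \<Longrightarrow> 0 \<le> x j" and cov: "cov_row I x i \<le> 1"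
    and load: "\<And>k. k < npack I \<Longrightarrow> pack_row I x k \<le> fail_bound I"
  shows "expsum I (phase I x i) \<le> expsum I x * (1 + 2 * step_size I x i)"
proof -
  let ?\<delta> = "\<lambda>k. \<Sum>j<nvars I. pcoef I k j * x j * gain I x i j"
  let ?w = "\<lambda>k. exp (pack_row I x k)"
  have S: "0 < expsum I x" using expsum_pos ompc_instance_npack_pos[OF I] .
  \<comment> \<open>Exchanging the sums over rows and variables makes the numerators of the rates
    appear.\<close>
  have "(\<Sum>k<npack I. ?w k * ?\<delta> k)
      = (\<Sum>j<nvars I. x j * gain I x i j * (\<Sum>k<npack I. pcoef I k j * ?w k))"
    unfolding sum_distrib_left by (subst sum.swap) (simp add: mult_ac)
  also have "\<dots> = (\<Sum>j<nvars I. expsum I x * (x j * (rate I x j * gain I x i j)))"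
    using S by (intro sum.cong) (auto simp: rate_def simp flip: expsum_def)
  also have "\<dots> = expsum I x * (step_size I x i * cov_row I x i)"
    unfolding cov_row_def sum_distrib_left
    by (intro sum.cong) (auto simp: gain_bounds(4)[OF I i] mult_ac)
  also have "\<dots> \<le> expsum I x * step_size I x i"
    using S cov step_size_nonneg_and_le(1)[OF I i, of x]
    by (simp add: mult_left_le)
  finally have main: "(\<Sum>k<npack I. ?w k * ?\<delta> k) \<le> expsum I x * step_size I x i" .
  have "expsum I (phase I x i) = (\<Sum>k<npack I. ?w k * exp (?\<delta> k))"
    by (simp add: expsum_def pack_row_phase exp_add)
  also have "\<dots> \<le> (\<Sum>k<npack I. ?w k * (1 + 2 * ?\<delta> k))"
    using pack_row_phase_bounds[OF I i _ x load] exp_le_linear by (intro sum_mono mult_left_mono) auto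
  also have "\<dots> = expsum I x + 2 * (\<Sum>k<npack I. ?w k * ?\<delta> k)"
    by (simp add: expsum_def algebra_simps sum.distrib sum_distrib_left)
  finally show ?thesis using main by (simp add: algebra_simps)
qed

section \<open>The dual certificate of a trial and its preservation\<close>

definition cov_feasible :: "ompc \<Rightarrow> (nat \<Rightarrow> real) \<Rightarrow> bool" where
  "cov_feasible I x \<longleftrightarrow> (\<forall>j<nvars I. 0 \<le> x j) \<and> (\<forall>i<ncov I. 1 \<le> cov_row I x i)"

text \<open>
  \<open>D\<close> is the sum of the step sizes so far and \<open>u\<^sub>j\<close> that of the products of step size and
  \<open>c\<^sub>i\<^sub>j\<close>. The softmax weights of the packing rows are not monotone in time; \<open>B\<close> is a monotone
  majorant of them, whose total mass grows no faster than the potential.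
\<close>

definition dual_certificate ::
  "ompc \<Rightarrow> (nat \<Rightarrow> real) \<Rightarrow> (nat \<Rightarrow> real) \<Rightarrow> (nat \<Rightarrow> real) \<Rightarrow> (nat \<Rightarrow> real) \<Rightarrow> real \<Rightarrow> bool" where
  "dual_certificate I x0 x B u D \<longleftrightarrow>
     (\<forall>k<npack I. exp (pack_row I x k) / expsum I x \<le> B k) \<and>
     (\<Sum>k<npack I. B k) \<le> 1 + potential I x - potential I x0 \<and>
     potential I x - potential I x0 \<le> 2 * D \<and>
     (\<forall>j<nvars I. u j \<le> 2 * (\<Sum>k<npack I. pcoef I k j * B k) * ln (x j / x0 j)) \<and>
     (\<forall>y. cov_feasible I y \<longrightarrow> D \<le> (\<Sum>j<nvars I. u j * y j))"

text \<open>The alternative \<open>x j = x0 j\<close> covers variables not yet raised, so that a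
  trial can start without any comparison of \<open>x0\<close> with \<open>U\<close>.\<close>

definition trial_inv :: "ompc \<Rightarrow> (nat \<Rightarrow> real) \<Rightarrow> real \<Rightarrow> (nat \<Rightarrow> real) \<Rightarrow> bool" where
  "trial_inv I x0 U x \<longleftrightarrow>
     (\<forall>j<nvars I. 0 < x0 j \<and> x0 j \<le> x j \<and> (x j = x0 j \<or> x j \<le> U)) \<and>
     (\<exists>B u D. dual_certificate I x0 x B u D)"

lemma trial_inv_init:
  assumes m: "0 < npack I" and x0: "\<And>j. j < nvars I \<Longrightarrow> 0 < x0 j"
  shows "trial_inv I x0 U x0"
proof -
  let ?B = "\<lambda>k. exp (pack_row I x0 k) / expsum I x0"
  have "(\<Sum>k<npack I. ?B k) = 1"
    using expsum_pos[OF m, of x0] by (simp add: expsum_def flip: sum_divide_distrib)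
  then have "dual_certificate I x0 x0 ?B (\<lambda>_. 0) 0"
    using x0 by (auto simp: dual_certificate_def less_imp_neq[symmetric])
  then show ?thesis unfolding trial_inv_def using x0 by blast
qed

text \<open>The phase contributes the step size to \<open>D\<close> and the step size times row
  \<open>i\<close> of the covering matrix to \<open>u\<close>. The five clauses are re-established
  one by one.\<close>

lemma dual_certificate_phase:
  assumes I: "ompc_instance I" and i: "i < ncov I"
    and x0: "\<And>j. j < nvars I \<Longrightarrow> 0 < x0 j" and x0x: "\<And>j. j < nvars I \<Longrightarrow> x0 j \<le> x j"
    and cov: "cov_row I x i \<le> 1"
    and load: "\<And>k. k < npack I \<Longrightarrow> pack_row I x k \<le> fail_bound I"
    and cert: "dual_certificate I x0 x B u D"
  shows "\<exists>B' u' D'. dual_certificate I x0 (phase I x i) B' u' D'"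
proof -
  let ?x = "phase I x i" and ?\<epsilon> = "step_size I x i"
  have m: "0 < npack I" using ompc_instance_npack_pos[OF I] .
  have x: "\<And>j. j < nvars I \<Longrightarrow> 0 < x j" using x0 x0x by force
  then have x_nn: "\<And>j. j < nvars I \<Longrightarrow> 0 \<le> x j" by (simp add: less_imp_le)
  have S: "0 < expsum I x" "0 < expsum I ?x" using expsum_pos[OF m] by auto
  have eps: "0 \<le> ?\<epsilon>" using step_size_nonneg_and_le(1)[OF I i] .
  have row: "pack_row I x k \<le> pack_row I ?x k" if "k < npack I" for k
    using pack_row_phase_bounds(1)[OF I i that x_nn load[OF that]] by (simp add: pack_row_phase)
  have Smono: "expsum I x \<le> expsum I ?x"
    unfolding expsum_def using row by (intro sum_mono) auto
  \<comment> \<open>The increment majorizes the rise of the softmax weight of row \<open>k\<close>: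
    since \<open>expsum\<close> does not decrease, the old exponential over the new sum is at most
    the old weight.\<close>
  define B' where "B' k = B k + (exp (pack_row I ?x k) - exp (pack_row I x k)) / expsum I ?x" for k
  define u' where "u' j = u j + ?\<epsilon> * ccoef I i j" for j
  from cert have w: "\<And>k. k < npack I \<Longrightarrow> exp (pack_row I x k) / expsum I x \<le> B k"
    and sumB: "(\<Sum>k<npack I. B k) \<le> 1 + potential I x - potential I x0"
    and pot: "potential I x - potential I x0 \<le> 2 * D"
    and u: "\<And>j. j < nvars I \<Longrightarrow> u j \<le> 2 * (\<Sum>k<npack I. pcoef I k j * B k) * ln (x j / x0 j)"
    and D: "\<And>y. cov_feasible I y \<Longrightarrow> D \<le> (\<Sum>j<nvars I. u j * y j)"
    unfolding dual_certificate_def by auto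
  have BB': "B k \<le> B' k" if "k < npack I" for k
    using row[OF that] S(2) by (simp add: B'_def)
  have w': "exp (pack_row I ?x k) / expsum I ?x \<le> B' k" if "k < npack I" for k
  proof -
    have "exp (pack_row I x k) / expsum I ?x \<le> exp (pack_row I x k) / expsum I x"
      using S Smono by (intro divide_left_mono) auto
    then show ?thesis using w[OF that] by (simp add: B'_def diff_divide_distrib)
  qed
  have "(\<Sum>k<npack I. B' k) = (\<Sum>k<npack I. B k) + (expsum I ?x - expsum I x) / expsum I ?x"
    unfolding B'_def sum.distrib by (simp add: expsum_def sum_subtractf flip: sum_divide_distrib)
  \<comment> \<open>Taking \<open>t\<close> as the ratio of new to old \<open>expsum\<close>, this
    is \<open>1 - 1 / t \<le> ln t\<close>, which telescopes over the phases.\<close>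
  also have "(expsum I ?x - expsum I x) / expsum I ?x \<le> potential I ?x - potential I x"
    using one_minus_inverse_le_ln[of "expsum I ?x / expsum I x"] S
    by (simp add: potential_def ln_div diff_divide_distrib)
  finally have sumB': "(\<Sum>k<npack I. B' k) \<le> 1 + potential I ?x - potential I x0"
    using sumB by linarith
  have "potential I ?x \<le> ln (expsum I x * (1 + 2 * ?\<epsilon>))"
    unfolding potential_def using S eps expsum_phase[OF I i x_nn cov load]
    by (subst ln_le_cancel_iff) auto
  also have "\<dots> = potential I x + ln (1 + 2 * ?\<epsilon>)"
    unfolding potential_def using S eps by (subst ln_mult) auto
  also have "ln (1 + 2 * ?\<epsilon>) \<le> 2 * ?\<epsilon>"
    using eps by (intro ln_add_one_self_le_self) auto
  finally have pot': "potential I ?x - potential I x0 \<le> 2 * (D + ?\<epsilon>)" using pot by simp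
  have uu': "u' j \<le> 2 * (\<Sum>k<npack I. pcoef I k j * B' k) * ln (?x j / x0 j)"
    if j: "j < nvars I" for j
  proof -
    let ?R = "\<Sum>k<npack I. pcoef I k j * B k" and ?R' = "\<Sum>k<npack I. pcoef I k j * B' k"
    note g = gain_bounds[OF I i j, of x]
    note p = ompc_instanceD(1)[OF I _ j]
    have "rate I x j \<le> ?R"
      unfolding rate_expsum using w p by (intro sum_mono mult_left_mono) auto
    also have R: "?R \<le> ?R'"
      using BB' p by (intro sum_mono mult_left_mono) auto
    finally have rR: "rate I x j \<le> ?R'" .
    have "0 \<le> rate I x j"
      unfolding rate_expsum using p S by (intro sum_nonneg) auto
    with rR have R'0: "0 \<le> ?R'" by linarith
    \<comment> \<open>The growth is at most 1, so it is bounded by twice its logarithm; the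
      logarithms of successive growth factors then add up to that of the total growth.\<close>
    have "?\<epsilon> * ccoef I i j \<le> ?R' * gain I x i j"
      using g(1) rR by (simp add: mult_right_mono flip: g(4))
    also have "\<dots> \<le> ?R' * (2 * ln (1 + gain I x i j))"
      using R'0 le_two_ln g(1,3) by (intro mult_left_mono) auto
    finally have 1: "?\<epsilon> * ccoef I i j \<le> 2 * ?R' * ln (1 + gain I x i j)" by simp
    have "0 \<le> ln (x j / x0 j)" using x0[OF j] x0x[OF j] by simp
    then have "2 * ?R * ln (x j / x0 j) \<le> 2 * ?R' * ln (x j / x0 j)"
      using R by (intro mult_right_mono) auto
    with u[OF j] have 2: "u j \<le> 2 * ?R' * ln (x j / x0 j)" by linarith
    have "ln (?x j / x0 j) = ln (x j / x0 j * (1 + gain I x i j))"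
      by (simp add: phase_gain)
    also have "\<dots> = ln (x j / x0 j) + ln (1 + gain I x i j)"
      using x[OF j] x0[OF j] g(1) by (subst ln_mult) auto
    finally show ?thesis using 1 2 by (simp add: u'_def distrib_left)
  qed
  have D': "D + ?\<epsilon> \<le> (\<Sum>j<nvars I. u' j * y j)" if y: "cov_feasible I y" for y
  proof -
    \<comment> \<open>Feasibility of \<open>y\<close> for row \<open>i\<close> pays for the increase
      of \<open>D\<close>.\<close>
    have "?\<epsilon> * 1 \<le> ?\<epsilon> * cov_row I y i"
      using y i eps unfolding cov_feasible_def by (intro mult_left_mono) auto
    moreover have "(\<Sum>j<nvars I. u' j * y j) = (\<Sum>j<nvars I. u j * y j) + ?\<epsilon> * cov_row I y i"
      by (simp add: u'_def cov_row_def algebra_simps sum.distrib sum_distrib_left)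
    ultimately show ?thesis using D[OF y] by linarith
  qed
  have "dual_certificate I x0 ?x B' u' (D + ?\<epsilon>)"
    unfolding dual_certificate_def using w' sumB' pot' uu' D' by blast
  then show ?thesis by blast
qed

text \<open>A variable is raised only while its constraint is violated, hence while
  \<open>x j\<close> is below the reciprocal of its coefficient, and it at most doubles. This gives
  the cap \<open>2 / ccoef I i j\<close> on its new value.\<close>

lemma trial_inv_phase:
  assumes I: "ompc_instance I" and i: "i < ncov I"
    and cov: "cov_row I x i < 1"
    and load: "\<And>k. k < npack I \<Longrightarrow> pack_row I x k \<le> fail_bound I"
    and U: "\<And>j. j < nvars I \<Longrightarrow> 0 < ccoef I i j \<Longrightarrow> 2 / ccoef I i j \<le> U"
    and inv: "trial_inv I x0 U x"
  shows "trial_inv I x0 U (phase I x i)"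
proof -
  from inv obtain B u D where x0: "\<And>j. j < nvars I \<Longrightarrow> 0 < x0 j"
    and x0x: "\<And>j. j < nvars I \<Longrightarrow> x0 j \<le> x j"
    and xU: "\<And>j. j < nvars I \<Longrightarrow> x j = x0 j \<or> x j \<le> U"
    and cert: "dual_certificate I x0 x B u D"
    unfolding trial_inv_def by blast
  have x: "\<And>j. j < nvars I \<Longrightarrow> 0 < x j" using x0 x0x by force
  have "x0 j \<le> phase I x i j \<and> (phase I x i j = x0 j \<or> phase I x i j \<le> U)"
    if j: "j < nvars I" for j
  proof (cases "ccoef I i j = 0")
    case True
    then have "phase I x i j = x j" by (simp add: phase_def)
    then show ?thesis using x0x[OF j] xU[OF j] by simp
  next
    case False
    then have c: "0 < ccoef I i j" using ompc_instanceD(2)[OF I i j] by simp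
    note g = gain_bounds[OF I i j, of x]
    have "ccoef I i j * x j \<le> cov_row I x i"
      unfolding cov_row_def using j ompc_instanceD(2)[OF I i] x
      by (intro member_le_sum) (auto simp: less_imp_le)
    with cov have "ccoef I i j * x j < 1" by linarith
    then have "2 * x j \<le> 2 / ccoef I i j" using c by (simp add: field_simps)
    moreover have "phase I x i j \<le> x j * 2"
      unfolding phase_gain using g(3) x[OF j] by (intro mult_left_mono) auto
    moreover have "x j * 1 \<le> phase I x i j"
      unfolding phase_gain using g(1) x[OF j] by (intro mult_left_mono) auto
    ultimately show ?thesis using U[OF j c] x0x[OF j] by linarith
  qed
  moreover have "\<exists>B' u' D'. dual_certificate I x0 (phase I x i) B' u' D'"
    using dual_certificate_phase[OF I i x0 x0x _ load cert] cov by simp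
  ultimately show ?thesis unfolding trial_inv_def using x0 by blast
qed

text \<open>Weak duality against \<open>y\<close> closes a loop. The rise of the potential is at
  most \<open>2 * D\<close>, thus at most \<open>4 * L * l\<close> times the mass of
  \<open>B\<close>, and that mass is at most 1 plus the rise. With
  \<open>4 * L * l \<le> 1 / 2\<close> the rise is at most 1.\<close>

lemma trial_inv_potential:
  assumes I: "ompc_instance I" and inv: "trial_inv I x0 U x"
    and L: "0 \<le> L" "\<And>j. j < nvars I \<Longrightarrow> ln (U / x0 j) \<le> L"
    and y: "cov_feasible I y" and l: "\<And>k. k < npack I \<Longrightarrow> pack_row I y k \<le> l"
    and small: "8 * L * l \<le> 1"
  shows "potential I x \<le> potential I x0 + 1"
proof -
  from inv obtain B u D where x0: "\<And>j. j < nvars I \<Longrightarrow> 0 < x0 j"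
    and x0x: "\<And>j. j < nvars I \<Longrightarrow> x0 j \<le> x j"
    and xU: "\<And>j. j < nvars I \<Longrightarrow> x j = x0 j \<or> x j \<le> U"
    and cert: "dual_certificate I x0 x B u D"
    unfolding trial_inv_def by blast
  have m: "0 < npack I" using ompc_instance_npack_pos[OF I] .
  let ?R = "\<lambda>j. \<Sum>k<npack I. pcoef I k j * B k"
  have B: "0 \<le> B k" if "k < npack I" for k
  proof -
    have "0 < exp (pack_row I x k) / expsum I x" using expsum_pos[OF m] by simp
    also have "\<dots> \<le> B k" using cert that unfolding dual_certificate_def by blast
    finally show ?thesis by simp
  qed
  have y0: "\<And>j. j < nvars I \<Longrightarrow> 0 \<le> y j" using y by (simp add: cov_feasible_def)
  have ln_le: "ln (x j / x0 j) \<le> L" if j: "j < nvars I" for j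
    using xU[OF j]
  proof
    assume "x j \<le> U"
    then have "ln (x j / x0 j) \<le> ln (U / x0 j)"
      using x0[OF j] x0x[OF j] by (subst ln_le_cancel_iff) (auto simp: divide_right_mono)
    then show ?thesis using L(2)[OF j] by linarith
  qed (use L(1) x0[OF j] in simp)
  have "D \<le> (\<Sum>j<nvars I. u j * y j)" using cert y unfolding dual_certificate_def by blast
  also have "\<dots> \<le> (\<Sum>j<nvars I. 2 * ?R j * L * y j)"
  proof (intro sum_mono mult_right_mono)
    fix j assume j: "j \<in> {..<nvars I}"
    have "0 \<le> ?R j" using B ompc_instanceD(1)[OF I] j by (intro sum_nonneg) auto
    then have "2 * ?R j * ln (x j / x0 j) \<le> 2 * ?R j * L"
      using ln_le j by (intro mult_left_mono) auto
    moreover have "u j \<le> 2 * ?R j * ln (x j / x0 j)"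
      using cert j unfolding dual_certificate_def by blast
    ultimately show "u j \<le> 2 * ?R j * L" by linarith
  qed (use y0 in auto)
  also have "\<dots> = 2 * L * (\<Sum>j<nvars I. \<Sum>k<npack I. B k * (pcoef I k j * y j))"
    unfolding sum_distrib_left sum_distrib_right by (simp add: mult_ac)
  \<comment> \<open>Swapping the sums turns the bound on variables into a \<open>B\<close>-weighted
    sum of the packing loads of \<open>y\<close>.\<close>
  also have "\<dots> = 2 * L * (\<Sum>k<npack I. B k * pack_row I y k)"
    unfolding pack_row_def by (subst sum.swap) (simp add: sum_distrib_left)
  also have "\<dots> \<le> 2 * L * (\<Sum>k<npack I. B k * l)"
    using L(1) B l by (intro mult_left_mono sum_mono) auto
  also have "\<dots> = 2 * L * l * (\<Sum>k<npack I. B k)"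
    by (simp add: mult_ac sum_distrib_left)
  finally have "2 * D \<le> (4 * L * l) * (\<Sum>k<npack I. B k)" by simp
  also have "\<dots> \<le> (1 / 2) * (\<Sum>k<npack I. B k)"
    using small B by (intro mult_right_mono sum_nonneg) auto
  finally show ?thesis using cert unfolding dual_certificate_def by linarith
qed

section \<open>Parameters of an instance\<close>

lemma finite_coef_sets:
  "finite {pcoef I k j |k j. k < npack I \<and> j < nvars I}"
  "finite {ccoef I i j |i j. i < ncov I \<and> j < nvars I}"
  "finite {pcoef I k j |k j. k < npack I \<and> j < nvars I \<and> 0 < pcoef I k j}"
  "finite {ccoef I i j |i j. i < ncov I \<and> j < nvars I \<and> 0 < ccoef I i j}"
proof -
  have fin: "finite {f a b |a b. a < n \<and> b < N \<and> P a b}"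
    for f :: "nat \<Rightarrow> nat \<Rightarrow> real" and n N P
    by (rule finite_subset[of _ "case_prod f ` ({..<n} \<times> {..<N})"]) auto
  show "finite {pcoef I k j |k j. k < npack I \<and> j < nvars I}"
    "finite {ccoef I i j |i j. i < ncov I \<and> j < nvars I}"
    using fin[where P = "\<lambda>_ _. True"] by simp_all
  show "finite {pcoef I k j |k j. k < npack I \<and> j < nvars I \<and> 0 < pcoef I k j}"
    "finite {ccoef I i j |i j. i < ncov I \<and> j < nvars I \<and> 0 < ccoef I i j}"
    by (rule fin)+
qed

lemma pack_params:
  assumes I: "ompc_instance I"
  shows "0 < pmax I" and "1 \<le> rho I"
    and "\<And>k j. k < npack I \<Longrightarrow> j < nvars I \<Longrightarrow> pcoef I k j \<le> pmax I"
    and "\<And>k j. k < npack I \<Longrightarrow> j < nvars I \<Longrightarrow> 0 < pcoef I k j \<Longrightarrow> pmax I / rho I \<le> pcoef I k j"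
proof -
  let ?S = "{pcoef I k j |k j. k < npack I \<and> j < nvars I \<and> 0 < pcoef I k j}"
  obtain k j where kj: "k < npack I" "j < nvars I" "0 < pcoef I k j"
    using ompc_instanceD(3-5)[OF I] by blast
  show le: "pcoef I k j \<le> pmax I" if "k < npack I" "j < nvars I" for k j
    unfolding pmax_def using that finite_coef_sets(1) by (intro Max_ge) auto
  have "Min ?S \<in> ?S" using kj finite_coef_sets(3) by (intro Min_in) auto
  then have min: "0 < Min ?S" "Min ?S \<le> pmax I" using le by auto
  then show pm: "0 < pmax I" by linarith
  show "1 \<le> rho I" unfolding rho_def using min by simp
  fix k j assume "k < npack I" "j < nvars I" "0 < pcoef I k j"
  then have "Min ?S \<le> pcoef I k j" using finite_coef_sets(3) by (intro Min_le) auto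
  then show "pmax I / rho I \<le> pcoef I k j" unfolding rho_def using min pm by simp
qed

text \<open>The last claim bounds coefficients of all rows although \<open>kappa_first\<close> sees
  only the first: it is at most the global maximum, and the global maximum over \<open>kappa\<close>
  is the smallest positive coefficient.\<close>

lemma cov_params:
  assumes I: "ompc_instance I"
  shows "0 < kappa_first I" and "1 \<le> kappa I"
    and "\<And>j. j < nvars I \<Longrightarrow> ccoef I 0 j \<le> kappa_first I"
    and "\<And>i j. i < ncov I \<Longrightarrow> j < nvars I \<Longrightarrow> 0 < ccoef I i j \<Longrightarrow>
      kappa_first I / kappa I \<le> ccoef I i j"
proof -
  let ?S = "{ccoef I i j |i j. i < ncov I \<and> j < nvars I \<and> 0 < ccoef I i j}"
  let ?T = "{ccoef I i j |i j. i < ncov I \<and> j < nvars I}"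
  have T1: "{ccoef I 0 j |j. j < nvars I} \<subseteq> ?T" using ompc_instanceD(5)[OF I] by blast
  have fin1: "finite {ccoef I 0 j |j. j < nvars I}" by auto
  obtain j where j: "j < nvars I" "0 < ccoef I 0 j"
    using ompc_instanceD(3,5)[OF I] by blast
  show le: "ccoef I 0 j \<le> kappa_first I" if "j < nvars I" for j
    unfolding kappa_first_def using that fin1 by (intro Max_ge) auto
  show k1: "0 < kappa_first I" using le j by force
  have k1T: "kappa_first I \<le> Max ?T"
    unfolding kappa_first_def using T1 finite_coef_sets(2) j by (intro Max_mono) auto
  have "Min ?S \<in> ?S" using j ompc_instanceD(5)[OF I] finite_coef_sets(4) by (intro Min_in) auto
  then have min: "0 < Min ?S" "Min ?S \<in> ?T" by auto
  then have minmax: "Min ?S \<le> Max ?T" using finite_coef_sets(2) by (intro Max_ge)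
  then show "1 \<le> kappa I" unfolding kappa_def using min by simp
  fix i j assume ij: "i < ncov I" "j < nvars I" "0 < ccoef I i j"
  then have "Min ?S \<le> ccoef I i j" using finite_coef_sets(4) by (intro Min_le) auto
  moreover have "kappa_first I / kappa I \<le> Min ?S"
  proof -
    have "kappa_first I * Min ?S \<le> Max ?T * Min ?S"
      using k1T min by (intro mult_right_mono) auto
    then show ?thesis unfolding kappa_def using min minmax by (simp add: field_simps)
  qed
  ultimately show "kappa_first I / kappa I \<le> ccoef I i j" by linarith
qed

lemma size_params:
  assumes I: "ompc_instance I"
  shows "1 \<le> d_first I" and "d_first I \<le> d_all I"
    and "\<And>k. k < npack I \<Longrightarrow> pack_size I k \<le> d_first I" and "cov_size I 0 \<le> d_first I"
proof -
  let ?A = "{pack_size I k |k. k < npack I} \<union> {cov_size I 0}"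
  let ?B = "{pack_size I k |k. k < npack I} \<union> {cov_size I i |i. i < ncov I}"
  have fin: "finite ?A" "finite ?B" by auto
  show "d_first I \<le> d_all I"
    unfolding d_first_def d_all_def using fin ompc_instanceD(5)[OF I] by (intro Max_mono) auto
  show "pack_size I k \<le> d_first I" if "k < npack I" for k
    unfolding d_first_def using fin that by (intro Max_ge) auto
  show le: "cov_size I 0 \<le> d_first I"
    unfolding d_first_def using fin by (intro Max_ge) auto
  obtain j where "j < nvars I" "0 < ccoef I 0 j"
    using ompc_instanceD(3,5)[OF I] by blast
  then have "j \<in> {j. j < nvars I \<and> ccoef I 0 j \<noteq> 0}" by auto
  then have "0 < cov_size I 0" unfolding cov_size_def by (subst card_gt_0_iff) auto
  with le show "1 \<le> d_first I" by linarith
qed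

section \<open>The starting point and lower bounds on the optimum\<close>

lemma x_init_pos: "ompc_instance I \<Longrightarrow> 0 < x_init I j"
  using pack_params(2)[of I] cov_params(1)[of I] size_params(1)[of I]
  by (auto simp: x_init_def)

lemma Gamma_init_pos: "ompc_instance I \<Longrightarrow> 0 < Gamma_init I"
  using pack_params(1,2)[of I] cov_params(1)[of I] size_params(1)[of I]
  by (auto simp: Gamma_init_def)

lemma sum_support_le:
  fixes f :: "nat \<Rightarrow> real"
  assumes "card {j. j < n \<and> f j \<noteq> 0} \<le> d" and "\<And>j. j < n \<Longrightarrow> f j \<noteq> 0 \<Longrightarrow> f j \<le> b" and "0 \<le> b"
  shows "(\<Sum>j<n. f j) \<le> d * b"
proof -
  have "(\<Sum>j<n. f j) = (\<Sum>j | j < n \<and> f j \<noteq> 0. f j)"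
    by (intro sum.mono_neutral_right) auto
  also have "\<dots> \<le> card {j. j < n \<and> f j \<noteq> 0} * b"
    using assms(2) by (intro sum_bounded_above) auto
  also have "\<dots> \<le> d * b"
    using assms by (intro mult_right_mono) auto
  finally show ?thesis .
qed

text \<open>A packing row has at most \<open>d_first I\<close> nonzero entries, each at most
  \<open>pmax I\<close>. The initial scaling parameter is exactly the resulting bound, so scaled
  starting loads are at most 1.\<close>

lemma max_load_x_init:
  assumes I: "ompc_instance I"
  shows "max_load I (x_init I) \<le> Gamma_init I"
  unfolding max_load_le_iff[OF ompc_instance_npack_pos[OF I]]
proof (intro allI impI)
  fix k assume k: "k < npack I"
  define x0 where "x0 = 1 / ((real (d_first I))\<^sup>2 * rho I * kappa_first I)"
  have x0: "0 < x0" using x_init_pos[OF I] by (simp add: x_init_def x0_def)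
  have "(\<Sum>j<nvars I. pcoef I k j * x0) \<le> d_first I * (pmax I * x0)"
    using x0 size_params(3)[OF I k] pack_params(1,3)[OF I] k
    by (intro sum_support_le) (auto simp: pack_size_def)
  also have "\<dots> = Gamma_init I"
    using size_params(1)[OF I] by (simp add: x0_def Gamma_init_def power2_eq_square)
  finally show "pack_row I (x_init I) k \<le> Gamma_init I"
    by (simp add: pack_row_def x_init_def x0_def)
qed

text \<open>By averaging, the first covering constraint forces some variable in it up to
  \<open>t\<close>, the reciprocal of \<open>d_first\<close> times \<open>kappa_first\<close>. That
  variable occurs in a packing row, where its coefficient is at least
  \<open>pmax I / rho I\<close>.\<close>

lemma Gamma_init_le:
  assumes I: "ompc_instance I" and y: "cov_feasible I y"
    and l: "\<And>k. k < npack I \<Longrightarrow> pack_row I y k \<le> l"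
  shows "Gamma_init I \<le> l"
proof -
  note par = pack_params[OF I] cov_params[OF I] size_params[OF I]
  have c0: "0 < ncov I" using ompc_instanceD(5)[OF I] .
  have y0: "\<And>j. j < nvars I \<Longrightarrow> 0 \<le> y j" and c1: "1 \<le> cov_row I y 0"
    using y c0 by (auto simp: cov_feasible_def)
  define t where "t = 1 / (real (d_first I) * kappa_first I)"
  have t: "0 < t" using par(5,9) by (simp add: t_def)
  have "\<exists>j<nvars I. 0 < ccoef I 0 j \<and> t \<le> y j"
  proof (rule ccontr)
    assume "\<not> ?thesis"
    then have small: "\<And>j. j < nvars I \<Longrightarrow> 0 < ccoef I 0 j \<Longrightarrow> y j < t" by force
    obtain i where i: "i < nvars I" "0 < ccoef I 0 i" using ompc_instanceD(3)[OF I c0] by blast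
    have "cov_row I y 0 < (\<Sum>j<nvars I. ccoef I 0 j * t)"
      unfolding cov_row_def
    proof (rule sum_strict_mono_ex1)
      show "\<forall>j\<in>{..<nvars I}. ccoef I 0 j * y j \<le> ccoef I 0 j * t"
        using small ompc_instanceD(2)[OF I c0] by (force simp: order_le_less)
      show "\<exists>j\<in>{..<nvars I}. ccoef I 0 j * y j < ccoef I 0 j * t"
        using small[OF i] i by (intro bexI[of _ i]) auto
    qed simp
    also have "\<dots> \<le> d_first I * (kappa_first I * t)"
      using t par(5,7,12) by (intro sum_support_le) (auto simp: cov_size_def)
    also have "\<dots> = 1" using par(5,9) by (simp add: t_def)
    finally show False using c1 by simp
  qed
  then obtain j where j: "j < nvars I" "0 < ccoef I 0 j" "t \<le> y j" by blast
  obtain k where k: "k < npack I" "0 < pcoef I k j" using ompc_instanceD(4)[OF I c0 j(1,2)] by blast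
  have "Gamma_init I = pmax I / rho I * t" by (simp add: Gamma_init_def t_def)
  also have "\<dots> \<le> pcoef I k j * y j"
    using j k t par(1,2,4) by (intro mult_mono) auto
  also have "\<dots> \<le> pack_row I y k"
    unfolding pack_row_def using j(1) y0 ompc_instanceD(1)[OF I k(1)]
    by (intro member_le_sum) auto
  finally show ?thesis using l[OF k(1)] by linarith
qed

text \<open>An infimum of reals is a greatest lower bound only of a nonempty set, so a feasible
  point is needed. Arguing with all feasible pairs avoids showing that the optimum is
  attained.\<close>

lemma le_OPT:
  assumes I: "ompc_instance I"
    and le: "\<And>y l. cov_feasible I y \<Longrightarrow> (\<And>k. k < npack I \<Longrightarrow> pack_row I y k \<le> l) \<Longrightarrow> b \<le> l"
  shows "b \<le> OPT I"
  unfolding OPT_def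
proof (rule cInf_greatest)
  \<comment> \<open>This constant is at least the reciprocal of every positive covering coefficient,
    so one such entry already satisfies its row.\<close>
  let ?t = "kappa I / kappa_first I" and ?y = "\<lambda>j::nat. kappa I / kappa_first I"
  note par = cov_params[OF I]
  have t: "0 < ?t" using par(1,2) by simp
  have "1 \<le> cov_row I ?y i" if i: "i < ncov I" for i
  proof -
    obtain j where j: "j < nvars I" "0 < ccoef I i j" using ompc_instanceD(3)[OF I i] by blast
    have "1 \<le> ccoef I i j * ?t" using par(4)[OF i j] par(1,2) by (simp add: field_simps)
    also have "\<dots> \<le> cov_row I ?y i"
      unfolding cov_row_def using t j(1) ompc_instanceD(2)[OF I i]
      by (intro member_le_sum mult_nonneg_nonneg) auto
    finally show ?thesis .
  qed
  with t have "max_load I ?y \<in> {l. \<exists>x. (\<forall>j<nvars I. 0 \<le> x j) \<and> (\<forall>i<ncov I. 1 \<le> cov_row I x i) \<and>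
      (\<forall>k<npack I. pack_row I x k \<le> l)}"
    using pack_row_le_max_load by (intro CollectI exI[of _ ?y]) auto
  then show "{l. \<exists>x. (\<forall>j<nvars I. 0 \<le> x j) \<and> (\<forall>i<ncov I. 1 \<le> cov_row I x i) \<and>
      (\<forall>k<npack I. pack_row I x k \<le> l)} \<noteq> {}" by (rule ex_in_conv[THEN iffD1, OF exI])
next
  fix l assume "l \<in> {l. \<exists>x. (\<forall>j<nvars I. 0 \<le> x j) \<and> (\<forall>i<ncov I. 1 \<le> cov_row I x i) \<and>
      (\<forall>k<npack I. pack_row I x k \<le> l)}"
  then show "b \<le> l" using le unfolding cov_feasible_def by blast
qed

section \<open>The doubling algorithm\<close>

lemma scaled_simps [simp]:
  "npack (scaled \<Gamma> I) = npack I" "ncov (scaled \<Gamma> I) = ncov I" "nvars (scaled \<Gamma> I) = nvars I"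
  "ccoef (scaled \<Gamma> I) = ccoef I" "pcoef (scaled \<Gamma> I) k j = pcoef I k j / \<Gamma>"
  "cov_row (scaled \<Gamma> I) = cov_row I" "fail_bound (scaled \<Gamma> I) = fail_bound I"
  "cov_feasible (scaled \<Gamma> I) = cov_feasible I" "pack_row (scaled \<Gamma> I) x k = pack_row I x k / \<Gamma>"
  by (simp_all add: scaled_def cov_row_def[abs_def] fail_bound_def cov_feasible_def[abs_def]
      pack_row_def sum_divide_distrib)

lemma ompc_instance_scaled: "ompc_instance I \<Longrightarrow> 0 < \<Gamma> \<Longrightarrow> ompc_instance (scaled \<Gamma> I)"
  by (auto simp: ompc_instance_def zero_less_divide_iff)

lemma max_load_scaled_le_iff:
  assumes "0 < npack I" and "0 < \<Gamma>"
  shows "max_load (scaled \<Gamma> I) x \<le> b \<longleftrightarrow> max_load I x \<le> b * \<Gamma>"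
  using assms by (simp add: max_load_le_iff pos_divide_le_eq)

text \<open>The cap on raised variables: twice the largest possible reciprocal of a positive
  covering coefficient.\<close>

definition var_ub :: "ompc \<Rightarrow> real" where
  "var_ub I = 2 * kappa I / kappa_first I"

definition log_factor :: "ompc \<Rightarrow> real" where
  "log_factor I = 3 * max 1 (ln (real (d_all I) * rho I * kappa I))"

text \<open>In the quotient \<open>kappa_first\<close> cancels, leaving twice \<open>d_first\<close>
  squared times \<open>rho\<close> and \<open>kappa\<close>. This is at most \<open>2 * q^2\<close>
  for \<open>q\<close> the product of \<open>d_all\<close>, \<open>rho\<close> and
  \<open>kappa\<close>. The maximum with 1 in \<open>log_factor\<close> absorbs
  \<open>ln 2\<close>.\<close>

lemma ln_var_ub_le:
  assumes I: "ompc_instance I"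
  shows "ln (var_ub I / x_init I j) \<le> log_factor I"
proof -
  note par = pack_params(2)[OF I] cov_params(1,2)[OF I] size_params(1,2)[OF I]
  let ?d = "real (d_all I)"
  have d: "1 \<le> ?d" using par(4,5) by linarith
  have ge1: "1 \<le> rho I * kappa I" using mult_mono[OF par(1,3)] par(1) by simp
  have pos: "0 < ?d * rho I * kappa I" using d par by simp
  have ln_2_square: "ln (2 * q\<^sup>2) = ln 2 + 2 * ln q" if "0 < q" for q :: real
    using that by (simp add: ln_mult ln_realpow)
  have "var_ub I / x_init I j = 2 * ((real (d_first I))\<^sup>2 * (rho I * kappa I))"
    using par by (simp add: var_ub_def x_init_def field_simps)
  also have "\<dots> \<le> 2 * (?d\<^sup>2 * (rho I * kappa I)\<^sup>2)"
    using par(5) ge1 self_le_power[OF ge1, of 2] by (intro mult_left_mono mult_mono power_mono) auto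
  also have "\<dots> = 2 * (?d * rho I * kappa I)\<^sup>2" by (simp add: power_mult_distrib)
  finally have le: "var_ub I / x_init I j \<le> 2 * (?d * rho I * kappa I)\<^sup>2" .
  have "0 < var_ub I / x_init I j"
    using par x_init_pos[OF I] by (simp add: var_ub_def)
  with le have "ln (var_ub I / x_init I j) \<le> ln (2 * (?d * rho I * kappa I)\<^sup>2)"
    by (rule ln_mono)
  also have "\<dots> = ln 2 + 2 * ln (?d * rho I * kappa I)"
    using pos ln_2_square by blast
  also have "ln (2::real) \<le> 1" using ln_le_minus_one[of 2] by simp
  finally show ?thesis unfolding log_factor_def by linarith
qed

lemma var_ub_ge:
  assumes I: "ompc_instance I" and "i < ncov I" "j < nvars I" "0 < ccoef I i j"
  shows "2 / ccoef I i j \<le> var_ub I"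
  using cov_params(1,2)[OF I] cov_params(4)[OF assms] assms(4)
  by (simp add: var_ub_def field_simps)

text \<open>The constant 16 is twice the 8 that a failure allows, since \<Gamma> is then doubled.
  The bound on the failed trials is a geometric sum in closed form: adding a load of
  \<open>2 * fail_bound I * \<Gamma>\<close> while \<Gamma> doubles preserves its shape.\<close>

fun config_inv :: "ompc \<Rightarrow> config \<Rightarrow> bool" where
  "config_inv I (\<Gamma>, zs, i, x) \<longleftrightarrow>
     Gamma_init I \<le> \<Gamma> \<and> \<Gamma> \<le> 16 * log_factor I * OPT I \<and>
     (\<Sum>z\<leftarrow>zs. max_load I z) \<le> 2 * fail_bound I * (\<Gamma> - Gamma_init I) \<and>
     trial_inv (scaled \<Gamma> I) (x_init I) (var_ub I) x \<and>
     max_load (scaled \<Gamma> I) x < fail_bound I"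

lemma trial_start:
  assumes I: "ompc_instance I" and \<Gamma>: "Gamma_init I \<le> \<Gamma>"
  shows "trial_inv (scaled \<Gamma> I) (x_init I) (var_ub I) (x_init I)"
    and "max_load (scaled \<Gamma> I) (x_init I) \<le> 1"
    and "max_load (scaled \<Gamma> I) (x_init I) < fail_bound I"
proof -
  have m: "0 < npack I" using ompc_instance_npack_pos[OF I] .
  show "trial_inv (scaled \<Gamma> I) (x_init I) (var_ub I) (x_init I)"
    using m x_init_pos[OF I] by (intro trial_inv_init) auto
  show 1: "max_load (scaled \<Gamma> I) (x_init I) \<le> 1"
    using max_load_x_init[OF I] \<Gamma> Gamma_init_pos[OF I] m by (subst max_load_scaled_le_iff) auto
  show "max_load (scaled \<Gamma> I) (x_init I) < fail_bound I"
    using 1 fail_bound_ge[OF m] by linarith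
qed

text \<open>If \<Gamma> were larger, the potential would rise by at most 1 from at most
  \<open>ln m + 1\<close>, so the load would stay at most \<open>ln m + 2\<close>, below the
  threshold \<open>3 * (1 + ln m)\<close>.\<close>

lemma failure_imp_Gamma_le:
  assumes I: "ompc_instance I" and \<Gamma>: "Gamma_init I \<le> \<Gamma>"
    and inv: "trial_inv (scaled \<Gamma> I) (x_init I) (var_ub I) x"
    and fail: "fail_bound I \<le> max_load (scaled \<Gamma> I) x"
  shows "\<Gamma> \<le> 8 * log_factor I * OPT I"
proof -
  let ?J = "scaled \<Gamma> I"
  have m: "0 < npack I" using ompc_instance_npack_pos[OF I] .
  have G: "0 < \<Gamma>" using \<Gamma> Gamma_init_pos[OF I] by linarith
  have L: "0 < log_factor I" by (simp add: log_factor_def)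
  have "\<Gamma> / (8 * log_factor I) \<le> OPT I"
  proof (rule le_OPT[OF I], rule ccontr)
    fix y l assume y: "cov_feasible I y" and l: "\<And>k. k < npack I \<Longrightarrow> pack_row I y k \<le> l"
      and "\<not> \<Gamma> / (8 * log_factor I) \<le> l"
    then have small: "8 * log_factor I * (l / \<Gamma>) \<le> 1" using G L by (simp add: field_simps)
    have "max_load ?J x \<le> potential ?J x" using m by (intro max_load_le_potential) simp
    also have "\<dots> \<le> potential ?J (x_init I) + 1"
      using ompc_instance_scaled[OF I G] inv _ _ _ _ small
    proof (rule trial_inv_potential)
    qed (use L G ln_var_ub_le[OF I] y l in \<open>auto simp: divide_right_mono\<close>)
    also have "potential ?J (x_init I) \<le> ln (npack I) + 1"
      using potential_le[of ?J, OF _ trial_start(2)[OF I \<Gamma>]] m by simp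
    finally have "max_load ?J x \<le> ln (npack I) + 2" by simp
    moreover have "0 \<le> ln (real (npack I))" using m by simp
    ultimately show False using fail fail_bound_eq[OF m] by argo
  qed
  then show ?thesis using L by (simp add: field_simps)
qed

lemma config_inv_step:
  assumes I: "ompc_instance I" and step: "doubling_step I c c'" and inv: "config_inv I c"
  shows "config_inv I c'"
proof -
  have m: "0 < npack I" using ompc_instance_npack_pos[OF I] .
  have G0: "0 < Gamma_init I" using Gamma_init_pos[OF I] .
  have phase: "trial_inv (scaled \<Gamma> I) (x_init I) (var_ub I) (phase (scaled \<Gamma> I) x i) \<and>
      max_load I (phase (scaled \<Gamma> I) x i) \<le> 2 * fail_bound I * \<Gamma>"
    if i: "i < ncov I" and cov: "cov_row I x i < 1" and inv: "config_inv I (\<Gamma>, zs, i, x)"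
    for \<Gamma> zs i x
  proof
    let ?J = "scaled \<Gamma> I"
    have G: "0 < \<Gamma>" using inv G0 by simp
    note J = ompc_instance_scaled[OF I G]
    have tr: "trial_inv ?J (x_init I) (var_ub I) x" and lt: "max_load ?J x < fail_bound I"
      using inv by auto
    have load: "pack_row ?J x k \<le> fail_bound ?J" if "k < npack ?J" for k
      using pack_row_le_max_load[OF that, of x] lt unfolding scaled_simps(7) by linarith
    show "trial_inv ?J (x_init I) (var_ub I) (phase ?J x i)"
      using J _ _ load _ tr
    proof (rule trial_inv_phase)
    qed (use i cov var_ub_ge[OF I] in auto)
    have x: "0 \<le> x j" if "j < nvars ?J" for j
      using tr that unfolding trial_inv_def by force
    \<comment> \<open>The last phase of a failing trial overshoots the threshold by at most 1, which
      is crudely bounded by another \<open>fail_bound I\<close>.\<close>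
    have "pack_row ?J (phase ?J x i) k \<le> 2 * fail_bound I" if k: "k < npack ?J" for k
      using pack_row_phase_bounds(2)[OF J _ k x load[OF k], of i] load[OF k] i
        fail_bound_ge[OF m] pack_row_phase[of ?J x i k]
      unfolding scaled_simps(2,7) by linarith
    then have "max_load ?J (phase ?J x i) \<le> 2 * fail_bound I"
      using m by (subst max_load_le_iff) auto
    then show "max_load I (phase ?J x i) \<le> 2 * fail_bound I * \<Gamma>"
      using max_load_scaled_le_iff[OF m G] by blast
  qed
  from step show ?thesis
  proof cases
    case (increase i x x' \<Gamma> zs)
    then show ?thesis using phase[of i x \<Gamma> zs] inv by simp
  next
    case (failure i x x' \<Gamma> zs)
    have inv': "config_inv I (\<Gamma>, zs, i, x)" using inv failure by simp
    note ph = phase[OF failure(3,4) inv', folded failure(5)]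
    have "\<Gamma> \<le> 8 * log_factor I * OPT I"
      using inv' ph failure(6) by (intro failure_imp_Gamma_le[OF I]) auto
    moreover have "(\<Sum>z\<leftarrow>zs @ [x']. max_load I z) \<le> 2 * fail_bound I * (2 * \<Gamma> - Gamma_init I)"
      using ph inv' by (simp add: algebra_simps)
    moreover have "Gamma_init I \<le> 2 * \<Gamma>" using inv' G0 by simp
    ultimately show ?thesis
      using trial_start[OF I, of "2 * \<Gamma>"] failure(2) by (simp add: mult_ac)
  \<comment> \<open>The two rules that leave a constraint change neither \<Gamma> nor any
    vector.\<close>
  qed (use inv in auto)
qed

text \<open>Failed trials contribute at most \<open>2 * fail_bound I * \<Gamma>\<close> and the last
  one at most \<open>fail_bound I * \<Gamma>\<close>, for the final \<Gamma>. Its bound with factor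
  16 gives 48.\<close>

lemma doubling_run_bound:
  assumes I: "ompc_instance I" and run: "doubling_run I xs"
  shows "(\<Sum>x\<leftarrow>xs. max_load I x) \<le> 48 * fail_bound I * log_factor I * OPT I"
proof -
  have m: "0 < npack I" using ompc_instance_npack_pos[OF I] .
  have G0: "0 < Gamma_init I" using Gamma_init_pos[OF I] .
  have F: "3 \<le> fail_bound I" using fail_bound_ge[OF m] .
  from run obtain \<Gamma> zs x where
    steps: "(doubling_step I)\<^sup>*\<^sup>* (Gamma_init I, [], 0, x_init I) (\<Gamma>, zs, ncov I, x)"
    and xs: "xs = zs @ [x]" unfolding doubling_run_def by blast
  \<comment> \<open>This makes the upper bound on \<Gamma> true at the start, before any
    failure.\<close>
  have "Gamma_init I \<le> OPT I" using Gamma_init_le[OF I] by (intro le_OPT[OF I]) auto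
  moreover from this G0 have "1 * OPT I \<le> 16 * log_factor I * OPT I"
    by (intro mult_right_mono) (auto simp: log_factor_def)
  ultimately have "config_inv I (Gamma_init I, [], 0, x_init I)"
    using trial_start[OF I order_refl] by simp
  with steps have inv: "config_inv I (\<Gamma>, zs, ncov I, x)"
    by (induction rule: rtranclp_induct) (auto intro: config_inv_step[OF I])
  then have G: "0 < \<Gamma>" "\<Gamma> \<le> 16 * log_factor I * OPT I" using G0 by auto
  have "max_load (scaled \<Gamma> I) x \<le> fail_bound I" using inv by simp
  then have x: "max_load I x \<le> fail_bound I * \<Gamma>"
    using max_load_scaled_le_iff[OF m G(1)] by blast
  have "0 \<le> fail_bound I * Gamma_init I" using F G0 by simp
  moreover have "0 \<le> fail_bound I * \<Gamma>" using F G by simp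
  ultimately have "(\<Sum>x\<leftarrow>xs. max_load I x) \<le> 3 * fail_bound I * \<Gamma>"
    using inv x unfolding xs by (simp add: algebra_simps)
  also have "\<dots> \<le> 3 * fail_bound I * (16 * log_factor I * OPT I)"
    using F G(2) by (intro mult_left_mono) auto
  finally show ?thesis by simp
qed

text \<open>The maxima with 1 give the asymptotic bound a meaning when a logarithm vanishes or is
  small, as for a single packing constraint.\<close>

theorem theorem12:
  "\<exists>K>0. \<forall>I xs. ompc_instance I \<longrightarrow> doubling_run I xs \<longrightarrow>
     (\<Sum>x\<leftarrow>xs. max_load I x)
       \<le> K * max 1 (ln (real (npack I))) * max 1 (ln (real (d_all I) * rho I * kappa I)) * OPT I \<and>
     max_load I (\<lambda>j. \<Sum>x\<leftarrow>xs. x j) \<le> (\<Sum>x\<leftarrow>xs. max_load I x)"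
\<comment> \<open>The constant is 48 * 6 * 3: the 6 bounds \<open>fail_bound\<close> by the maximum
  of 1 and \<open>ln m\<close>, and the 3 is the factor in \<open>log_factor\<close>.\<close>
proof (intro exI[of _ 864] conjI allI impI)
  fix I xs assume I: "ompc_instance I" and run: "doubling_run I xs"
  have m: "0 < npack I" using ompc_instance_npack_pos[OF I] .
  have "0 \<le> OPT I"
    using Gamma_init_le[OF I] Gamma_init_pos[OF I] by (intro le_OPT[OF I]) force
  moreover have "fail_bound I \<le> 6 * max 1 (ln (npack I))" by (simp add: fail_bound_eq[OF m])
  moreover have "0 < log_factor I" by (simp add: log_factor_def)
  ultimately have "48 * fail_bound I * log_factor I * OPT I
      \<le> 48 * (6 * max 1 (ln (npack I))) * log_factor I * OPT I"
    by (intro mult_right_mono mult_left_mono) auto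
  with doubling_run_bound[OF I run]
  show "(\<Sum>x\<leftarrow>xs. max_load I x) \<le> 864 * max 1 (ln (real (npack I)))
      * max 1 (ln (real (d_all I) * rho I * kappa I)) * OPT I"
    by (simp add: log_factor_def mult_ac)
  show "max_load I (\<lambda>j. \<Sum>x\<leftarrow>xs. x j) \<le> (\<Sum>x\<leftarrow>xs. max_load I x)"
    using max_load_sum_list[OF m] .
qed simp

end
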